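(* Let $\mathcal{M}$ be a regular matroid of rank $r>0$ on $n$ elements, and let $M_1, M_2 \in \mathbb{R}^{r\times n}$ be two full-rank weakly unimodular matrices, each representing $\mathcal{M}$. Then there exists $F \in \mathrm{GL}_r(\mathbb{Z})$ such that \[\mathcal{P}_{M_2} = \psi_F(\mathcal{P}_{M_1}) \quad\text{and}\quad \mathcal{P}_{M_2}^{\Delta} = \psi_{(F^T)^{-1}}(\mathcal{P}_{M_1}^{\Delta}).\]
   Context: A matrix $M\in\mathbb{R}^{r\times n}$ with $0<r\le n$ is called full-rank weakly unimodular if it has rank $r$ and every $r\times r$ minor of $M$ lies in $\{0,1,-1\}$ (such a matrix with rank $r$ necessarily has integer-valued relevant structure; in the paper these matrices are integer matrices). A matrix $M$ represents a matroid $\mathcal{M}$ if the matroid on the column index set $[n]$, in which a set of indices is independent iff the corresponding columns are linearly independent, is isomorphic to $\mathcal{M}$. A matroid of positive rank is regular if it can be represented by a full-rank weakly unimodular matrix (equivalently, by a totally unimodular matrix). For a matrix $M$ with $r$ rows, $\mathcal{P}_M \subseteq \mathbb{R}^r$ denotes the polytope $\mathrm{conv}$ of the columns of the $r\times 2n$ matrix $[M\mid -M]$. For $F\in \mathrm{GL}_r(\mathbb{Z})$, $\psi_F:\mathbb{R}^r\to\mathbb{R}^r$ is the linear map $\mathbf{x}\mapsto F\mathbf{x}$. For a full-dimensional polytope $P\subseteq\mathbb{R}^r$ with the origin in its interior, the polar is $P^{\Delta}=\{\mathbf{u}\in\mathbb{R}^r : \mathbf{u}\cdot\mathbf{x}\le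 1 \text{ for all } \mathbf{x}\in P\}$. *)

theory Defs
  imports "HOL-Analysis.Analysis"
begin

locale matroid =
  fixes E :: "'a set" and indep :: "'a set \<Rightarrow> bool"
  assumes finite_ground: "finite E"
    and indep_subset_ground: "indep X \<Longrightarrow> X \<subseteq> E"
    and indep_empty: "indep {}"
    and indep_subset: "indep X \<Longrightarrow> Y \<subseteq> X \<Longrightarrow> indep Y"
    and augment: "indep X \<Longrightarrow> indep Y \<Longrightarrow> card Y < card X \<Longrightarrow> \<exists>x\<in>X - Y. indep (insert x Y)"

definition matroid_rank :: "('a set \<Rightarrow> bool) \<Rightarrow> nat"
  where "matroid_rank indep = Max (card ` {X. indep X})"

definition matroid_isomorphic ::
    "'a set \<Rightarrow> ('a set \<Rightarrow> bool) \<Rightarrow> 'b set \<Rightarrow> ('b set \<Rightarrow> bool) \<Rightarrow> bool"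
  where "matroid_isomorphic E indep E' indep' \<longleftrightarrow>
    (\<exists>\<phi>. bij_betw \<phi> E E' \<and> (\<forall>X\<subseteq>E. indep X \<longleftrightarrow> indep' (\<phi> ` X)))"

text \<open>The columns indexed by \<open>J\<close> are taken as a family: equal columns at two distinct indices
  are linearly dependent, hence the injectivity condition.\<close>

definition column_indep :: "real^'n^'r \<Rightarrow> 'n set \<Rightarrow> bool"
  where "column_indep M J \<longleftrightarrow>
    inj_on (\<lambda>j. column j M) J \<and> independent ((\<lambda>j. column j M) ` J)"

lemma matroid_column_indep: "matroid UNIV (column_indep (M :: real^'n^'r))"
proof
  fix X Y :: "'n set"
  assume X: "column_indep M X" and Y: "column_indep M Y" and less: "card Y < card X"
  let ?c = "\<lambda>j. column j M"
  have "\<exists>x\<in>X. ?c x \<notin> span (?c ` Y)"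
  proof (rule ccontr)
    assume "\<not> ?thesis"
    then have "?c ` X \<subseteq> span (?c ` Y)" by blast
    moreover have "independent (?c ` X)" using X by (simp add: column_indep_def)
    ultimately have "card (?c ` X) \<le> card (?c ` Y)"
      using independent_span_bound[of "?c ` Y" "?c ` X"] by simp
    moreover have "card (?c ` X) = card X" "card (?c ` Y) = card Y"
      using X Y by (simp_all add: column_indep_def card_image)
    ultimately show False using less by simp
  qed
  then obtain x where x: "x \<in> X" "?c x \<notin> span (?c ` Y)" by blast
  have nin: "?c x \<notin> ?c ` Y" using x(2) span_superset[of "?c ` Y"] by (meson subsetD)
  then have "x \<notin> Y" by blast
  moreover have "column_indep M (insert x Y)"
    using Y x(2) nin by (auto simp: column_indep_def independent_insert)
  ultimately show "\<exists>x\<in>X - Y. column_indep M (insert x Y)" using x(1) by blast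
next
  fix X Y :: "'n set"
  assume "column_indep M X" "Y \<subseteq> X"
  then show "column_indep M Y"
    unfolding column_indep_def by (meson image_mono independent_mono inj_on_subset)
qed (simp_all add: column_indep_def independent_empty)

definition represents :: "real^'n^'r \<Rightarrow> 'a set \<Rightarrow> ('a set \<Rightarrow> bool) \<Rightarrow> bool"
  where "represents M E indep \<longleftrightarrow> matroid_isomorphic UNIV (column_indep M) E indep"

text \<open>Integrality of the entries is part of the notion: it does not follow from the condition on
  the minors, which is invariant under left multiplication by any real matrix of determinant 1.
  Since the index types carry no order, a maximal minor is given by an injective choice of columns
  and is thus determined up to sign only; the set of admitted values is closed under sign.\<close>

definition full_rank_weakly_unimodular :: "real^'n^'r \<Rightarrow> bool"
  where "full_rank_weakly_unimodular M \<longleftrightarrow>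
    CARD('r) \<le> CARD('n) \<and>
    (\<forall>i j. M $ i $ j \<in> \<int>) \<and>
    rank M = CARD('r) \<and>
    (\<forall>c :: 'r \<Rightarrow> 'n. inj c \<longrightarrow> det (\<chi> i j. M $ i $ c j) \<in> {0, 1, -1})"

text \<open>The type arguments only fix the shape of the representing matrix. A full-rank matrix
  representing a matroid has as many rows as the rank and as many columns as there are elements
  (see \<open>represents_card\<close> and \<open>represents_rank\<close> below), so no generality is lost when these types
  have the matching cardinalities.\<close>

definition regular_matroid ::
    "'r::finite itself \<Rightarrow> 'n::finite itself \<Rightarrow> 'a set \<Rightarrow> ('a set \<Rightarrow> bool) \<Rightarrow> bool"
  where "regular_matroid _ _ E indep \<longleftrightarrow>
    matroid E indep \<and> 0 < matroid_rank indep \<and>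
    (\<exists>M :: real^'n^'r. full_rank_weakly_unimodular M \<and> represents M E indep)"

lemma represents_card:
  assumes "represents (M :: real^'n^'r) E indep"
  shows "card E = CARD('n)"
  using assms unfolding represents_def matroid_isomorphic_def
  by (auto dest: bij_betw_same_card)

lemma matroid_rank_column_indep: "matroid_rank (column_indep M) = rank (M :: real^'n^'r)"
proof -
  let ?c = "\<lambda>j. column j M"
  have cols: "columns M = range ?c" by (auto simp: columns_def)
  obtain B where B: "B \<subseteq> columns M" "independent B" "card B = dim (columns M)"
    by (rule basis_exists)
  obtain J where J: "inj_on ?c J" "B = ?c ` J"
    using B(1) unfolding cols subset_image_inj by blast
  have "column_indep M J" using J B by (simp add: column_indep_def)
  moreover have "card J = rank M" using J B by (simp add: card_image column_rank_def)
  moreover have "card X \<le> rank M" if "column_indep M X" for X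
  proof -
    have "card (?c ` X) \<le> dim (columns M)"
      using that independent_card_le_dim[of "?c ` X" "columns M"]
      by (auto simp: column_indep_def cols)
    then show ?thesis using that by (simp add: column_indep_def card_image column_rank_def)
  qed
  ultimately show ?thesis
    unfolding matroid_rank_def by (intro Max_eqI) (auto intro: image_eqI[where x = J])
qed

lemma represents_rank:
  assumes "matroid E indep" and "represents (M :: real^'n^'r) E indep"
  shows "matroid_rank indep = rank M"
proof -
  obtain \<phi> where \<phi>: "bij_betw \<phi> UNIV E" "\<And>X. column_indep M X \<longleftrightarrow> indep (\<phi> ` X)"
    using assms(2) unfolding represents_def matroid_isomorphic_def by auto
  have inj: "inj \<phi>" and ran: "range \<phi> = E" using \<phi>(1) by (auto simp: bij_betw_def)
  have card: "card (\<phi> ` X) = card X" for X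
    using inj by (meson card_image inj_on_subset subset_UNIV)
  have "{X. indep X} = (`) \<phi> ` {X. column_indep M X}"
  proof (intro equalityI subsetI)
    fix Y assume "Y \<in> {X. indep X}"
    moreover from this have "Y \<subseteq> range \<phi>"
      using matroid.indep_subset_ground[OF assms(1)] ran by simp
    then obtain X where "Y = \<phi> ` X" by (auto simp: subset_image_iff)
    ultimately show "Y \<in> (`) \<phi> ` {X. column_indep M X}" using \<phi>(2) by auto
  qed (use \<phi>(2) in auto)
  then have "card ` {X. indep X} = card ` {X. column_indep M X}"
    by (simp add: image_image card)
  then show ?thesis
    using matroid_rank_column_indep[of M] by (simp add: matroid_rank_def)
qed

text \<open>The block matrix $[M \mid -M]$.\<close>

definition sym_block :: "real^'n^'r \<Rightarrow> real^('n + 'n)^'r"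
  where "sym_block M = (\<chi> i k. case k of Inl j \<Rightarrow> M $ i $ j | Inr j \<Rightarrow> - (M $ i $ j))"

definition sym_polytope :: "real^'n^'r \<Rightarrow> (real^'r) set"
  where "sym_polytope M = convex hull (columns (sym_block M))"

definition psi :: "int^'r^'r \<Rightarrow> real^'r \<Rightarrow> real^'r"
  where "psi F x = map_matrix real_of_int F *v x"

definition polar :: "(real^'r) set \<Rightarrow> (real^'r) set"
  where "polar P = {u. \<forall>x\<in>P. u \<bullet> x \<le> 1}"

end

theory Submission
  imports Defs
begin

text \<open>After relabelling columns both matrices have the same bases. Inverting the square submatrix on
  a common basis is an integral operation, and by Cramer's rule it turns each matrix into one with
  entries \<open>0, 1, -1\<close> and unit columns on the basis. It remains to see that two such matrices
  \<open>D\<^sub>1, D\<^sub>2\<close> with the same column matroid differ by signs of rows and columns only. They have the same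
  support. Suppose they already agree on a set of columns, and that in a further column the ratio
  \<open>D\<^sub>2 / D\<^sub>1\<close> differs at two rows which are connected through the supports of the earlier columns. A
  shortest connecting walk closes up to a chordless cycle, and the cycle submatrix is singular for
  exactly one of the two matrices, contradicting that the matroids agree.\<close>

section \<open>Spans along chordless paths\<close>

lemma in_span_axes:
  fixes x :: "real^'r"
  assumes "\<And>i. i \<notin> I \<Longrightarrow> x $ i = 0" and "(\<lambda>i. axis i 1) ` I \<subseteq> S"
  shows "x \<in> span S"
proof -
  have sum: "(\<Sum>i\<in>UNIV. x $ i *\<^sub>R axis i 1) = x"
    using basis_expansion[of x] by (simp add: scalar_mult_eq_scaleR)
  have "x $ i *\<^sub>R axis i 1 \<in> span S" for i
  proof (cases "i \<in> I")
    case True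
    then have "axis i 1 \<in> S" using assms(2) by blast
    then show ?thesis by (intro span_mul span_base)
  qed (use assms(1) in \<open>simp add: span_zero\<close>)
  then have "(\<Sum>i\<in>UNIV. x $ i *\<^sub>R axis i 1) \<in> span S" by (rule span_sum)
  then show ?thesis by (simp only: sum)
qed

text \<open>Cuts out the \<open>d\<close> vertices after \<open>p a\<close>. Normally the walk jumps
  to \<open>p (Suc (a + d))\<close> and needs that edge; if the cut reaches the end, the walk stops
  at \<open>p a\<close>, which must then equal the old endpoint. This serves both for deleting a
  closed detour and for following a chord.\<close>

lemma walk_shortcut:
  fixes p :: "nat \<Rightarrow> 'b"
  assumes walk: "\<forall>l<n. R (p l) (p (Suc l))"
    and "a + d \<le> n"
    and short: "a + d < n \<Longrightarrow> R (p a) (p (Suc (a + d)))"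
    and short': "a + d = n \<Longrightarrow> p a = p n"
  obtains p' where "\<forall>l<n - d. R (p' l) (p' (Suc l))" "p' 0 = p 0" "p' (n - d) = p n"
proof
  let ?p = "\<lambda>k. if k \<le> a then p k else p (k + d)"
  show "\<forall>l<n - d. R (?p l) (?p (Suc l))"
  proof (intro allI impI)
    fix l assume l: "l < n - d"
    consider "l < a" | "l = a" | "a < l" by linarith
    then show "R (?p l) (?p (Suc l))"
    proof cases
      case 1
      then have "l < n" using l by simp
      then show ?thesis using walk 1 by auto
    next
      case 2
      then show ?thesis using short l by auto
    next
      case 3
      then have "l + d < n" using l by simp
      then have "R (p (l + d)) (p (Suc (l + d)))" using walk by blast
      then show ?thesis using 3 by simp
    qed
  qed
  show "?p 0 = p 0" by simp
  show "?p (n - d) = p n"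
  proof (cases "a + d = n")
    case True
    then have "n - d = a" by simp
    then show ?thesis using short'[OF True] by simp
  qed (use assms(2) in auto)
qed

text \<open>The right-hand side is the linear functional on the coordinates along the path that vanishes on
  all \<open>q l\<close>; its coefficients are propagated from \<open>1\<close> at \<open>p 0\<close>.\<close>

lemma in_span_chordless_path_iff:
  fixes x :: "real^'r" and p :: "nat \<Rightarrow> 'r" and q :: "nat \<Rightarrow> real^'r"
  assumes n: "0 < n" and inj: "inj_on p {..n}"
    and q: "\<And>l i. l < n \<Longrightarrow> q l $ i \<in> {0, 1, -1}"
    and ends: "\<And>l. l < n \<Longrightarrow> q l $ p l \<noteq> 0" "\<And>l. l < n \<Longrightarrow> q l $ p (Suc l) \<noteq> 0"
    and chordless: "\<And>l k. l < n \<Longrightarrow> k \<le> n \<Longrightarrow> k \<noteq> l \<Longrightarrow> k \<noteq> Suc l \<Longrightarrow> q l $ p k = 0"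
    and x: "\<And>l. 0 < l \<Longrightarrow> l < n \<Longrightarrow> x $ p l = 0"
  shows "x \<in> span (q ` {..<n} \<union> (\<lambda>i. axis i 1) ` (- p ` {..n})) \<longleftrightarrow>
    x $ p 0 + (\<Prod>k<n. - (q k $ p k * q k $ p (Suc k))) * x $ p n = 0"
proof -
  define S where "S = q ` {..<n} \<union> (\<lambda>i. axis i (1::real)) ` (- p ` {..n})"
  \<comment> \<open>\<open>y\<close> is forced by \<open>f (q k) = 0\<close>: on the path,
    \<open>q k\<close> is nonzero only at \<open>p k\<close> and \<open>p (Suc k)\<close>, so this
    equation fixes the ratio of two consecutive coefficients. Dividing by an entry is multiplying by
    it, as it is a sign.\<close>
  define y where "y l = (\<Prod>k<l. - (q k $ p k * q k $ p (Suc k)))" for l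
  define e where "e l = (axis (p l) 1 :: real^'r)" for l
  define f where "f z = (\<Sum>l\<le>n. y l * z $ p l)" for z :: "real^'r"
  have sq: "q l $ p l * q l $ p l = 1" "q l $ p (Suc l) * q l $ p (Suc l) = 1" if "l < n" for l
    using q[OF that, of "p l"] q[OF that, of "p (Suc l)"] ends[OF that] by auto
  have y0: "y 0 = 1" by (simp add: y_def)
  have ySuc: "y (Suc l) = - y l * (q l $ p l * q l $ p (Suc l))" for l
    by (simp add: y_def)
  have ysq: "y l * y l = 1" if "l \<le> n" for l
    using that
  proof (induction l)
    case (Suc l)
    have "y (Suc l) * y (Suc l)
      = (y l * y l) * (q l $ p l * q l $ p l) * (q l $ p (Suc l) * q l $ p (Suc l))"
      by (simp add: ySuc)
    then show ?case using Suc sq[of l] by simp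
  qed (simp add: y0)
  have lin: "linear f"
    unfolding f_def by (rule linearI) (simp_all add: algebra_simps sum.distrib sum_distrib_left)
  have f_two: "f z = y a * z $ p a + y b * z $ p b"
    if "a \<noteq> b" "a \<le> n" "b \<le> n" "\<And>l. l \<le> n \<Longrightarrow> l \<noteq> a \<Longrightarrow> l \<noteq> b \<Longrightarrow> z $ p l = 0" for z a b
  proof -
    have "f z = (\<Sum>l\<in>{a, b}. y l * z $ p l)"
      unfolding f_def by (rule sum.mono_neutral_right) (use that in auto)
    then show ?thesis using that(1) by simp
  qed
  have "f z = 0" if "z \<in> S" for z
  proof -
    consider l where "l < n" "z = q l" | i where "i \<notin> p ` {..n}" "z = axis i 1"
      using \<open>z \<in> S\<close> unfolding S_def by blast
    then show ?thesis
    proof cases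
      case 1
      then have "f z = y l * q l $ p l + y (Suc l) * q l $ p (Suc l)"
        using chordless by (simp add: f_two[of l "Suc l"])
      also have "\<dots> = y l * q l $ p l * (1 - q l $ p (Suc l) * q l $ p (Suc l))"
        by (simp add: ySuc algebra_simps)
      finally show ?thesis using sq 1 by simp
    next
      case 2
      then show ?thesis unfolding f_def by (intro sum.neutral) (auto simp: axis_def)
    qed
  qed
  then have f0: "f z = 0" if "z \<in> span S" for z
    using linear_eq_0_on_span[OF lin _ that] by blast
  have outside: "z \<in> span S" if "\<And>l. l \<le> n \<Longrightarrow> z $ p l = 0" for z
    by (rule in_span_axes[of "- p ` {..n}"]) (use that in \<open>auto simp: S_def\<close>)
  have e_nth: "e l $ p k = (if k = l then 1 else 0)" if "l \<le> n" "k \<le> n" for l k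
    using that inj by (auto simp: e_def axis_def inj_on_def)
  \<comment> \<open>Up to off-path axes, \<open>q l\<close> is a combination of two consecutive path
    axes; scaling it by \<open>y l * ?a\<close> yields differences that telescope.\<close>
  have step: "y l *\<^sub>R e l - y (Suc l) *\<^sub>R e (Suc l) \<in> span S" if l: "l < n" for l
  proof -
    let ?a = "q l $ p l" and ?b = "q l $ p (Suc l)"
    have "q l - (?a *\<^sub>R e l + ?b *\<^sub>R e (Suc l)) \<in> span S"
      by (rule outside) (use l chordless e_nth in auto)
    moreover have "q l \<in> span S" using l by (auto simp: S_def intro: span_base)
    ultimately have "?a *\<^sub>R e l + ?b *\<^sub>R e (Suc l) \<in> span S"
      by (metis span_diff diff_diff_eq2 add_diff_cancel_left' add.commute)
    then have "(y l * ?a) *\<^sub>R (?a *\<^sub>R e l + ?b *\<^sub>R e (Suc l)) \<in> span S"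
      by (rule span_mul)
    moreover have "(y l * ?a) *\<^sub>R (?a *\<^sub>R e l + ?b *\<^sub>R e (Suc l))
        = (y l * (?a * ?a)) *\<^sub>R e l - y (Suc l) *\<^sub>R e (Suc l)"
      by (simp add: ySuc algebra_simps)
    ultimately show ?thesis using sq(1)[OF l] by simp
  qed
  \<comment> \<open>Modulo \<open>span S\<close> all path axes are thus sign multiples of
    \<open>e 0\<close>, so the kernel of \<open>f\<close> is no larger than
    \<open>span S\<close>.\<close>
  have tele: "e 0 - y l *\<^sub>R e l \<in> span S" if "l \<le> n" for l
    using that
  proof (induction l)
    case (Suc l)
    have "(e 0 - y l *\<^sub>R e l) + (y l *\<^sub>R e l - y (Suc l) *\<^sub>R e (Suc l)) \<in> span S"
      using Suc step by (intro span_add) auto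
    then show ?case by simp
  qed (simp add: y0 span_zero)
  have fx: "f x = x $ p 0 + y n * x $ p n"
    using f_two[of 0 n x] n x y0 by (simp)
  have "x \<in> span S" if "f x = 0"
  proof -
    have "y n * (y n * x $ p n) = - (y n * x $ p 0)"
      using that fx by (simp add: add_eq_0_iff)
    then have xn: "x $ p n = - (x $ p 0 * y n)"
      using ysq[of n] by (simp flip: mult.assoc)
    \<comment> \<open>On the path \<open>x\<close> lives only at the two ends, and
      \<open>f x = 0\<close> makes that part a multiple of
      \<open>e 0 - y n *\<^sub>R e n\<close>.\<close>
    have "x - (x $ p 0 *\<^sub>R e 0 + x $ p n *\<^sub>R e n) \<in> span S"
    proof (rule outside)
      fix l assume "l \<le> n"
      then show "(x - (x $ p 0 *\<^sub>R e 0 + x $ p n *\<^sub>R e n)) $ p l = 0"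
        using x[of l] n e_nth[of 0 l] e_nth[of n l] by (cases "l = 0"; cases "l = n") auto
    qed
    moreover have "x $ p 0 *\<^sub>R (e 0 - y n *\<^sub>R e n) \<in> span S"
      using tele by (intro span_mul) auto
    ultimately have "x - (x $ p 0 *\<^sub>R e 0 + x $ p n *\<^sub>R e n) + x $ p 0 *\<^sub>R (e 0 - y n *\<^sub>R e n) \<in> span S"
      by (rule span_add)
    then show ?thesis by (simp add: xn algebra_simps)
  qed
  then show ?thesis using f0[of x] fx unfolding S_def y_def by auto
qed

section \<open>Comparing signs within a connected component\<close>

text \<open>Strong induction on the length. A walk meeting the support of \<open>v\<close> in its
  interior is split there; one with a repeated vertex or a chord is shortened. What remains is a
  chordless path on which \<open>v\<close> and \<open>w\<close> vanish inside, and there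
  \<open>same\<close> compares a single sign equation for the two vectors.\<close>

lemma sign_product_constant_along_walk:
  fixes Q :: "(real^'r) set" and v w :: "real^'r"
  assumes Q: "\<And>q i. q \<in> Q \<Longrightarrow> q $ i \<in> {0, 1, -1}"
    and v: "\<And>i. v $ i \<in> {0, 1, -1}" and w: "\<And>i. w $ i \<in> {0, 1, -1}"
    and supp: "\<And>i. v $ i = 0 \<longleftrightarrow> w $ i = 0"
    and same: "\<And>P I. P \<subseteq> Q \<Longrightarrow>
      v \<in> span (P \<union> (\<lambda>i. axis i 1) ` I) \<longleftrightarrow> w \<in> span (P \<union> (\<lambda>i. axis i 1) ` I)"
    and walk: "\<forall>l<n. \<exists>q\<in>Q. q $ p l \<noteq> 0 \<and> q $ p (Suc l) \<noteq> 0"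
    and "v $ p 0 \<noteq> 0" "v $ p n \<noteq> 0"
  shows "v $ p 0 * w $ p 0 = v $ p n * w $ p n"
  using walk assms(7,8)
proof (induction n arbitrary: p rule: less_induct)
  case (less n)
  let ?R = "\<lambda>i k. \<exists>q\<in>Q. q $ i \<noteq> 0 \<and> q $ k \<noteq> 0"
  have shortcut: ?case
    if d: "0 < d" "a + d \<le> n" "a + d < n \<Longrightarrow> ?R (p a) (p (Suc (a + d)))" "a + d = n \<Longrightarrow> p a = p n"
    for a d
  proof -
    obtain p' where p': "\<forall>l<n - d. ?R (p' l) (p' (Suc l))" "p' 0 = p 0" "p' (n - d) = p n"
      using walk_shortcut[of n ?R p a d] less.prems(1) d by blast
    then show ?thesis using less.IH[of "n - d" p'] less.prems d by simp
  qed
  consider "n = 0"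
    | l where "0 < l" "l < n" "v $ p l \<noteq> 0"
    | a b where "a < b" "b \<le> n" "p a = p b"
    | a b where "Suc a < b" "b \<le> n" "?R (p a) (p b)"
    | "0 < n" "\<And>l. 0 < l \<Longrightarrow> l < n \<Longrightarrow> v $ p l = 0"
      "\<And>a b. a < b \<Longrightarrow> b \<le> n \<Longrightarrow> p a \<noteq> p b"
      "\<And>a b. Suc a < b \<Longrightarrow> b \<le> n \<Longrightarrow> \<not> ?R (p a) (p b)"
    by blast
  then show ?case
  proof cases
    case 1
    then show ?thesis by simp
  next
    case 2
    have "v $ p 0 * w $ p 0 = v $ p l * w $ p l"
      using less.IH[of l p] less.prems 2 by auto
    \<comment> \<open>The summand \<open>0\<close> puts the claim into the form of the induction
      hypothesis for the shifted walk.\<close>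
    moreover have "v $ p (l + 0) * w $ p (l + 0) = v $ p (l + (n - l)) * w $ p (l + (n - l))"
      using 2 less.prems by (intro less.IH[of "n - l" "\<lambda>k. p (l + k)"]) auto
    ultimately show ?thesis using 2 by simp
  next
    case 3
    then show ?thesis using shortcut[of "b - a" a] less.prems(1) by auto
  next
    case 4
    then have "Suc (a + (b - a - 1)) = b" by simp
    \<comment> \<open>Removing one vertex fewer than \<open>b - a\<close> keeps \<open>p b\<close>,
      the far end of the chord.\<close>
    then show ?thesis using shortcut[of "b - a - 1" a] 4 by auto
  next
    case 5
    obtain q where q: "\<And>l. l < n \<Longrightarrow> q l \<in> Q \<and> q l $ p l \<noteq> 0 \<and> q l $ p (Suc l) \<noteq> 0"
      using less.prems(1) by metis
    have inj: "inj_on p {..n}"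
      by (rule linorder_inj_onI) (use 5(3) in auto)
    \<comment> \<open>A further nonzero entry of \<open>q l\<close> at \<open>p k\<close> would join
      \<open>p k\<close> to the more distant of \<open>p l\<close> and \<open>p (Suc l)\<close>,
      which is a chord.\<close>
    have chordless: "q l $ p k = 0" if "l < n" "k \<le> n" "k \<noteq> l" "k \<noteq> Suc l" for l k
    proof (cases "k < l")
      case True
      then show ?thesis using 5(4)[of k "Suc l"] q[of l] that by auto
    next
      case False
      then show ?thesis using 5(4)[of l k] q[of l] that by auto
    qed
    let ?y = "\<Prod>k<n. - (q k $ p k * q k $ p (Suc k))"
    let ?S = "span (q ` {..<n} \<union> (\<lambda>i. axis i 1) ` (- p ` {..n}))"
    have iff: "x \<in> ?S \<longleftrightarrow> x $ p 0 + ?y * x $ p n = 0"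
      if "\<And>l. 0 < l \<Longrightarrow> l < n \<Longrightarrow> x $ p l = 0" for x
      by (rule in_span_chordless_path_iff)
        (use 5(1) inj chordless q Q that in auto)
    have "v \<in> ?S \<longleftrightarrow> w \<in> ?S" by (rule same) (use q in auto)
    then have eq: "v $ p 0 + ?y * v $ p n = 0 \<longleftrightarrow> w $ p 0 + ?y * w $ p n = 0"
      using iff[of v] iff[of w] 5(2) supp by simp
    have y: "?y \<in> {1, -1}"
    proof -
      have "\<bar>?y\<bar> = (\<Prod>k<n. 1)"
        unfolding abs_prod
      proof (rule prod.cong)
        fix k assume "k \<in> {..<n}"
        then show "\<bar>- (q k $ p k * q k $ p (Suc k))\<bar> = 1"
          using q[of k] Q[of "q k" "p k"] Q[of "q k" "p (Suc k)"] by auto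
      qed simp
      then show ?thesis by auto
    qed
    \<comment> \<open>For signs, \<open>a + y * b = 0\<close> means \<open>a * b = - y\<close>. So
      \<open>eq\<close> forces the products of the two end entries of \<open>v\<close> and of
      \<open>w\<close> to coincide, which rearranges to the claim.\<close>
    have "v $ p 0 \<in> {1, -1}" "v $ p n \<in> {1, -1}" "w $ p 0 \<in> {1, -1}" "w $ p n \<in> {1, -1}"
      using v[of "p 0"] v[of "p n"] w[of "p 0"] w[of "p n"] supp less.prems(2,3) by auto
    then show ?thesis using y eq by auto
  qed
qed

lemma rtranclp_walk:
  assumes "R\<^sup>*\<^sup>* x y"
  obtains p :: "nat \<Rightarrow> 'b" and n where "p 0 = x" "p n = y" "\<forall>l<n. R (p l) (p (Suc l))"
proof -
  obtain n where "(R ^^ n) x y" using assms by (auto simp: rtranclp_power)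
  then show thesis using that unfolding relpowp_fun_conv by blast
qed

text \<open>Constancy along walks gives the ratio of \<open>w\<close> to \<open>v\<close> one value
  per connected component, where two rows are adjacent if some vector of \<open>Q\<close> is nonzero
  at both. The last property of \<open>g\<close> is what later allows a row flip to be undone on the
  columns in \<open>Q\<close>.\<close>

lemma exists_component_signs:
  fixes Q :: "(real^'r) set" and v w :: "real^'r"
  assumes Q: "\<And>q i. q \<in> Q \<Longrightarrow> q $ i \<in> {0, 1, -1}"
    and v: "\<And>i. v $ i \<in> {0, 1, -1}" and w: "\<And>i. w $ i \<in> {0, 1, -1}"
    and supp: "\<And>i. v $ i = 0 \<longleftrightarrow> w $ i = 0"
    and same: "\<And>P I. P \<subseteq> Q \<Longrightarrow>
      v \<in> span (P \<union> (\<lambda>i. axis i 1) ` I) \<longleftrightarrow> w \<in> span (P \<union> (\<lambda>i. axis i 1) ` I)"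
  obtains g :: "'r \<Rightarrow> real" where "\<And>i. g i \<in> {1, -1}" "\<And>i. w $ i = g i * v $ i"
    "\<And>q i k. q \<in> Q \<Longrightarrow> q $ i \<noteq> 0 \<Longrightarrow> q $ k \<noteq> 0 \<Longrightarrow> g i = g k"
proof -
  define R where "R i k \<longleftrightarrow> (\<exists>q\<in>Q. q $ i \<noteq> 0 \<and> q $ k \<noteq> 0)" for i k
  have sym: "R\<^sup>*\<^sup>* k i" if "R\<^sup>*\<^sup>* i k" for i k
    by (rule sympD[OF symp_rtranclp that]) (auto simp: symp_def R_def)
  have const: "v $ i * w $ i = v $ k * w $ k" if "R\<^sup>*\<^sup>* i k" "v $ i \<noteq> 0" "v $ k \<noteq> 0" for i k
  proof -
    obtain p n where "p 0 = i" "p n = k" "\<forall>l<n. R (p l) (p (Suc l))"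
      using rtranclp_walk[OF \<open>R\<^sup>*\<^sup>* i k\<close>] by metis
    then show ?thesis
      using sign_product_constant_along_walk[OF Q v w supp same, where n = n and p = p] that
      unfolding R_def by auto
  qed
  define T where "T i k \<longleftrightarrow> R\<^sup>*\<^sup>* i k \<and> v $ k \<noteq> 0" for i k
  \<comment> \<open>A component on which \<open>v\<close> vanishes imposes no condition; its sign is
    set to \<open>1\<close>.\<close>
  define g where "g i = (if \<exists>k. T i k then v $ (SOME k. T i k) * w $ (SOME k. T i k) else 1)" for i
  have g: "g i = v $ k * w $ k" if "T i k" for i k
  proof -
    have "T i (SOME k. T i k)" using that by (rule someI)
    then have "v $ k * w $ k = v $ (SOME k. T i k) * w $ (SOME k. T i k)"
      using that sym by (intro const) (auto simp: T_def intro: rtranclp_trans)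
    then show ?thesis using that by (auto simp: g_def)
  qed
  have vw: "v $ k * w $ k \<in> {1, -1}" if "v $ k \<noteq> 0" for k
    using v[of k] w[of k] supp[of k] that by auto
  show thesis
  proof
    fix i
    show "g i \<in> {1, -1}"
    proof (cases "\<exists>k. T i k")
      case True
      then obtain k where "T i k" by blast
      then show ?thesis using g vw[of k] by (auto simp: T_def)
    qed (simp add: g_def)
    show "w $ i = g i * v $ i"
    proof (cases "v $ i = 0")
      case False
      then have "g i = v $ i * w $ i" using g[of i i] by (simp add: T_def)
      then show ?thesis using v[of i] False by auto
    qed (use supp in auto)
  next
    fix q i k assume "q \<in> Q" "q $ i \<noteq> 0" "q $ k \<noteq> 0"
    then have "R i k" by (auto simp: R_def)
    then have "R\<^sup>*\<^sup>* i k" by (rule r_into_rtranclp)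
    \<comment> \<open>Equality as predicates makes the choice operator pick the same row for
      \<open>i\<close> and \<open>k\<close>, and also makes the default case agree.\<close>
    then have "T i = T k" using sym by (auto simp: T_def fun_eq_iff intro: rtranclp_trans)
    then show "g i = g k" by (simp add: g_def)
  qed
qed

section \<open>Standard forms with the same column matroid\<close>

lemma in_span_axes_iff:
  fixes x :: "real^'r"
  shows "x \<in> span ((\<lambda>i. axis i 1) ` I) \<longleftrightarrow> (\<forall>i. i \<notin> I \<longrightarrow> x $ i = 0)"
proof
  assume x: "x \<in> span ((\<lambda>i. axis i 1) ` I)"
  show "\<forall>i. i \<notin> I \<longrightarrow> x $ i = 0"
  proof (intro allI impI)
    fix i assume "i \<notin> I"
    have "linear (\<lambda>z::real^'r. z $ i)" by (rule linearI) auto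
    moreover have "z $ i = 0" if "z \<in> (\<lambda>i. axis i 1) ` I" for z :: "real^'r"
      using \<open>i \<notin> I\<close> that by (auto simp: axis_def)
    ultimately show "x $ i = 0" using x by (rule linear_eq_0_on_span)
  qed
qed (use in_span_axes[of I x] in blast)

lemma linear_image_in_span:
  assumes "linear h" and "\<And>z. z \<in> S \<Longrightarrow> h z \<in> span T" and "x \<in> span S"
  shows "h x \<in> span T"
proof -
  have "h ` span S = span (h ` S)" using assms(1) by (simp add: linear_span_image)
  also have "\<dots> \<subseteq> span T" by (rule span_minimal) (use assms(2) in auto)
  finally show ?thesis using assms(3) by blast
qed

text \<open>Lying in a span is matroid closure. A maximal independent subfamily \<open>Y\<close> of
  \<open>X\<close> has the same span for \<open>M\<close>; adjoining a new \<open>j\<close> makes it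
  dependent, and this dependence carries over to \<open>N\<close>, where \<open>Y\<close> is still
  independent.\<close>

lemma column_in_span_transfer:
  fixes M :: "real^'n^'r" and N :: "real^'n^'s"
  assumes eq: "\<And>X. column_indep M X \<longleftrightarrow> column_indep N X"
    and j: "column j M \<in> span ((\<lambda>j. column j M) ` X)"
  shows "column j N \<in> span ((\<lambda>j. column j N) ` X)"
proof -
  let ?m = "\<lambda>j. column j M" and ?n = "\<lambda>j. column j N"
  obtain B where B: "B \<subseteq> ?m ` X" "independent B" "?m ` X \<subseteq> span B"
    by (rule maximal_independent_subset)
  obtain Y where Y: "Y \<subseteq> X" "inj_on ?m Y" "B = ?m ` Y"
    using B(1) unfolding subset_image_inj by blast
  have M: "column_indep M Y" using B Y by (simp add: column_indep_def)
  have jB: "?m j \<in> span (?m ` Y)"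
    using j B(3) Y(3) by (metis span_mono span_span subsetD)
  have "?n j \<in> span (?n ` Y)"
  proof (cases "j \<in> Y")
    case True
    then show ?thesis by (auto intro: span_base)
  next
    case False
    have "\<not> column_indep M (insert j Y)"
    proof
      assume *: "column_indep M (insert j Y)"
      then have "?m j \<notin> ?m ` Y" using False by (auto simp: column_indep_def inj_on_def)
      then show False
        using * jB by (simp add: column_indep_def independent_insert)
    qed
    then have N: "\<not> column_indep N (insert j Y)" and "column_indep N Y" using eq M by auto
    show ?thesis
    proof (rule ccontr)
      assume nin: "?n j \<notin> span (?n ` Y)"
      then have "?n j \<notin> ?n ` Y" using span_superset[of "?n ` Y"] by (meson subsetD)
      then have "column_indep N (insert j Y)"
        using nin \<open>column_indep N Y\<close> by (auto simp: column_indep_def independent_insert)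
      then show False using N by blast
    qed
  qed
  then show ?thesis using Y(1) by (meson image_mono span_mono subsetD)
qed

text \<open>The columns are matched one at a time. Flipping the sign of all rows in a connected component
  of the support of the columns treated so far can be undone by flipping those columns, so a new
  column may prescribe one sign per component.\<close>

lemma same_matroid_standard_form_signs:
  fixes D\<^sub>1 D\<^sub>2 :: "real^'n^'r" and c :: "'r \<Rightarrow> 'n"
  assumes ent: "\<And>i j. D\<^sub>1 $ i $ j \<in> {0, 1, -1}" "\<And>i j. D\<^sub>2 $ i $ j \<in> {0, 1, -1}"
    and unit: "\<And>i. column (c i) D\<^sub>1 = axis i 1" "\<And>i. column (c i) D\<^sub>2 = axis i 1"
    and eq: "\<And>X. column_indep D\<^sub>1 X \<longleftrightarrow> column_indep D\<^sub>2 X"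
  obtains s :: "'r \<Rightarrow> real" and t :: "'n \<Rightarrow> real"
  where "\<And>i. s i \<in> {1, -1}" "\<And>j. t j \<in> {1, -1}" "\<And>i j. D\<^sub>2 $ i $ j = s i * D\<^sub>1 $ i $ j * t j"
proof -
  let ?d1 = "\<lambda>j. column j D\<^sub>1" and ?d2 = "\<lambda>j. column j D\<^sub>2"
  have span_iff: "?d1 j \<in> span (?d1 ` X) \<longleftrightarrow> ?d2 j \<in> span (?d2 ` X)" for j X
    using column_in_span_transfer[of D\<^sub>1 D\<^sub>2] column_in_span_transfer[of D\<^sub>2 D\<^sub>1] eq by blast
  have supp: "D\<^sub>1 $ i $ j = 0 \<longleftrightarrow> D\<^sub>2 $ i $ j = 0" for i j
  proof -
    \<comment> \<open>An entry in row \<open>i\<close> vanishes iff its column lies in the span of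
      the unit columns other than the \<open>i\<close>-th, which is matroid data.\<close>
    have "?d1 j $ i = 0 \<longleftrightarrow> ?d2 j $ i = 0"
      using span_iff[of j "c ` (- {i})"] by (simp add: image_image unit in_span_axes_iff)
    then show ?thesis by (simp add: column_def)
  qed
  have "\<exists>s t. (\<forall>i. s i \<in> {1, -1::real}) \<and> (\<forall>j. t j \<in> {1, -1::real}) \<and>
      (\<forall>j\<in>J. \<forall>i. D\<^sub>2 $ i $ j = s i * D\<^sub>1 $ i $ j * t j)" for J
    using finite[of J]
  proof (induction J rule: finite_induct)
    case empty
    show ?case by (intro exI[of _ "\<lambda>_. 1"]) auto
  next
    case (insert j J)
    then obtain s t where s: "\<And>i. s i \<in> {1, -1::real}" and t: "\<And>j. t j \<in> {1, -1::real}"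
      and st: "\<And>i j. j \<in> J \<Longrightarrow> D\<^sub>2 $ i $ j = s i * D\<^sub>1 $ i $ j * t j" by blast
    have ss: "s i * s i = 1" for i using s[of i] by auto
    have tt: "t k * t k = 1" for k using t[of k] by auto
    \<comment> \<open>The row flip \<open>h\<close> carries the columns of \<open>D\<^sub>1\<close>
      in \<open>J\<close> to those of \<open>D\<^sub>2\<close> up to sign, and likewise the unit
      columns.\<close>
    define h :: "real^'r \<Rightarrow> real^'r" where "h x = (\<chi> i. s i * x $ i)" for x
    have lin: "linear h"
      by (rule linearI) (auto simp: h_def vec_eq_iff algebra_simps)
    have hh: "h (h x) = x" for x by (simp add: h_def vec_eq_iff ss flip: mult.assoc)
    have h_axis: "h (axis i 1) = s i *\<^sub>R axis i 1" for i
      by (simp add: h_def vec_eq_iff axis_def)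
    have h1: "h (?d1 k) = t k *\<^sub>R ?d2 k" if "k \<in> J" for k
      using st[OF that] tt[of k] by (auto simp: h_def vec_eq_iff column_def algebra_simps)
    have h2: "h (?d2 k) = t k *\<^sub>R ?d1 k" if "k \<in> J" for k
    proof -
      have "t k *\<^sub>R h (?d2 k) = ?d1 k"
        using h1[OF that] hh[of "?d1 k"] linear_cmul[OF lin] by metis
      then show ?thesis using tt[of k] by (metis scaleR_scaleR scaleR_one)
    qed
    \<comment> \<open>Only columns in \<open>J\<close> or \<open>range c\<close> are known to be
      matched by \<open>h\<close>, so only these may span; the column \<open>j\<close> itself is
      arbitrary.\<close>
    have h_span: "h (?d1 j) \<in> span (?d2 ` X) \<longleftrightarrow> ?d1 j \<in> span (?d1 ` X)"
      if "X \<subseteq> J \<union> range c" for X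
    proof -
      have a: "h z \<in> span (?d2 ` X)" if "z \<in> ?d1 ` X" for z
      proof -
        from that obtain k where k: "k \<in> X" "z = ?d1 k" by blast
        have "?d2 k \<in> span (?d2 ` X)" using k by (auto intro: span_base)
        moreover have "k \<in> J \<or> (\<exists>i. k = c i)" using k \<open>X \<subseteq> J \<union> range c\<close> by auto
        ultimately show ?thesis
          using k h1 h_axis unit by (metis span_mul)
      qed
      have b: "h z \<in> span (?d1 ` X)" if "z \<in> ?d2 ` X" for z
      proof -
        from that obtain k where k: "k \<in> X" "z = ?d2 k" by blast
        have "?d1 k \<in> span (?d1 ` X)" using k by (auto intro: span_base)
        moreover have "k \<in> J \<or> (\<exists>i. k = c i)" using k \<open>X \<subseteq> J \<union> range c\<close> by auto
        ultimately show ?thesis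
          using k h2 h_axis unit by (metis span_mul)
      qed
      show ?thesis
        using linear_image_in_span[OF lin a, where x = "?d1 j"]
          linear_image_in_span[OF lin b, where x = "h (?d1 j)"]
        by (auto simp: hh)
    qed
    \<comment> \<open>The graph comes from the columns already matched; the new column of
      \<open>D\<^sub>1\<close>, with its rows flipped by \<open>h\<close>, is compared with that of
      \<open>D\<^sub>2\<close>.\<close>
    obtain g :: "'r \<Rightarrow> real" where g: "\<And>i. g i \<in> {1, -1}" "\<And>i. ?d2 j $ i = g i * h (?d1 j) $ i"
      "\<And>q i k. q \<in> ?d2 ` J \<Longrightarrow> q $ i \<noteq> 0 \<Longrightarrow> q $ k \<noteq> 0 \<Longrightarrow> g i = g k"
    proof (rule exists_component_signs[of "?d2 ` J" "h (?d1 j)" "?d2 j"])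
      show "q $ i \<in> {0, 1, -1}" if "q \<in> ?d2 ` J" for q i
      proof -
        from that obtain k where "q = ?d2 k" by blast
        then show ?thesis using ent(2)[of i k] by (simp add: column_def)
      qed
      show "h (?d1 j) $ i \<in> {0, 1, -1}" for i
        using ent(1)[of i j] s[of i] by (auto simp: h_def column_def)
      show "?d2 j $ i \<in> {0, 1, -1}" for i using ent(2) by (simp add: column_def)
      show "h (?d1 j) $ i = 0 \<longleftrightarrow> ?d2 j $ i = 0" for i
        using supp[of i j] s[of i] by (auto simp: h_def column_def)
      show "h (?d1 j) \<in> span (P \<union> (\<lambda>i. axis i 1) ` I) \<longleftrightarrow> ?d2 j \<in> span (P \<union> (\<lambda>i. axis i 1) ` I)"
        if "P \<subseteq> ?d2 ` J" for P I
      proof -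
        from that obtain K where K: "K \<subseteq> J" "P = ?d2 ` K" by (auto simp: subset_image_iff)
        have P: "P \<union> (\<lambda>i. axis i 1) ` I = ?d2 ` (K \<union> c ` I)"
          by (simp add: K image_Un image_image unit)
        show ?thesis
          unfolding P using h_span[of "K \<union> c ` I"] span_iff[of j "K \<union> c ` I"] K by auto
      qed
    qed blast
    \<comment> \<open>The support of a column in \<open>J\<close> lies in one component, so
      \<open>g\<close> has a single value on it; a zero column gets \<open>1\<close>.\<close>
    define \<epsilon> where "\<epsilon> k = (if \<exists>i. D\<^sub>2 $ i $ k \<noteq> 0 then g (SOME i. D\<^sub>2 $ i $ k \<noteq> 0) else 1)" for k
    have \<epsilon>: "\<epsilon> k \<in> {1, -1}" for k using g(1) by (auto simp: \<epsilon>_def)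
    have \<epsilon>g: "\<epsilon> k = g i" if "k \<in> J" "D\<^sub>2 $ i $ k \<noteq> 0" for k i
    proof -
      have "D\<^sub>2 $ (SOME i. D\<^sub>2 $ i $ k \<noteq> 0) $ k \<noteq> 0" using that(2) by (rule someI)
      then show ?thesis
        using g(3)[of "?d2 k" "SOME i. D\<^sub>2 $ i $ k \<noteq> 0" i] that by (auto simp: \<epsilon>_def column_def)
    qed
    define s' where "s' i = g i * s i" for i
    \<comment> \<open>On earlier columns \<open>\<epsilon>\<close> cancels the flip by
      \<open>g\<close>; the new column is already matched by \<open>s'\<close> alone.\<close>
    define t' where "t' k = (if k = j then 1 else t k * \<epsilon> k)" for k
    have "s' i \<in> {1, -1}" for i using g(1)[of i] s[of i] by (auto simp: s'_def)
    moreover have "t' k \<in> {1, -1}" for k using \<epsilon>[of k] t[of k] by (auto simp: t'_def)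
    moreover have "D\<^sub>2 $ i $ k = s' i * D\<^sub>1 $ i $ k * t' k" if "k \<in> insert j J" for i k
    proof (cases "k = j")
      case True
      then show ?thesis using g(2)[of i] by (simp add: s'_def t'_def h_def column_def)
    next
      case False
      then have k: "k \<in> J" using that by blast
      show ?thesis
      proof (cases "D\<^sub>2 $ i $ k = 0")
        case True
        then show ?thesis using supp by simp
      next
        case nz: False
        have "g i * g i = 1" using g(1)[of i] by auto
        then have "s' i * D\<^sub>1 $ i $ k * t' k = s i * D\<^sub>1 $ i $ k * t k"
          using \<epsilon>g[OF k nz] False by (simp add: s'_def t'_def)
        then show ?thesis using st[OF k] by metis
      qed
    qed
    ultimately show ?case by blast
  qed
  from this[of UNIV] show thesis using that by blast
qed

section \<open>Integral reduction to standard form\<close>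

lemma det_in_Ints:
  fixes A :: "real^'r^'r"
  assumes "\<And>i j. A $ i $ j \<in> \<int>"
  shows "det A \<in> \<int>"
  unfolding det_def by (intro Ints_sum Ints_mult Ints_prod) (use assms in auto)

lemma column_matrix_mult: "column j (A ** B) = A *v column j B"
  by (simp add: vec_eq_iff column_def matrix_matrix_mult_def matrix_vector_mult_def)

lemma column_indep_invertible_mult:
  fixes L :: "real^'r^'r" and M :: "real^'n^'r"
  assumes "invertible L"
  shows "column_indep (L ** M) X \<longleftrightarrow> column_indep M X"
proof -
  have inj: "inj ((*v) L)" by (rule inj_matrix_vector_mult[OF assms])
  obtain K where K: "L ** K = mat 1" "K ** L = mat 1" using assms by (auto simp: invertible_def)
  then have "invertible K" by (auto simp: invertible_def)
  then have inj_K: "inj_on ((*v) K) S" for S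
    using inj_matrix_vector_mult inj_on_subset by blast
  have "inj_on (\<lambda>j. column j (L ** M)) X \<longleftrightarrow> inj_on (\<lambda>j. column j M) X"
    using inj by (auto simp: inj_on_def column_matrix_mult)
  moreover have "(\<lambda>j. column j (L ** M)) ` X = (*v) L ` (\<lambda>j. column j M) ` X"
    by (simp add: image_image column_matrix_mult)
  moreover have "independent ((*v) L ` S) \<longleftrightarrow> independent S" for S
  proof
    assume "independent ((*v) L ` S)"
    then have "independent ((*v) K ` (*v) L ` S)"
      using inj_K by (rule linear_independent_injective_image[OF matrix_vector_mul_linear])
    then show "independent S" by (simp add: image_image matrix_vector_mul_assoc K)
  next
    assume "independent S"
    then show "independent ((*v) L ` S)"
      using inj inj_on_subset
      by (intro linear_independent_injective_image[OF matrix_vector_mul_linear]) blast+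
  qed
  ultimately show ?thesis by (simp add: column_indep_def)
qed

text \<open>The basis block \<open>A\<close> has determinant \<open>1\<close> or \<open>-1\<close>,
  being a nonzero maximal minor. By Cramer's rule the entries of \<open>L\<close> are integral
  determinants up to sign, and those of \<open>L ** M\<close> are maximal minors of \<open>M\<close>
  up to sign.\<close>

lemma weakly_unimodular_standard_form:
  fixes M :: "real^'n^'r" and c :: "'r \<Rightarrow> 'n"
  assumes int: "\<And>i j. M $ i $ j \<in> \<int>"
    and minors: "\<And>c :: 'r \<Rightarrow> 'n. inj c \<Longrightarrow> det (\<chi> i j. M $ i $ c j) \<in> {0, 1, -1}"
    and c: "inj c" "column_indep M (range c)"
  obtains A L :: "real^'r^'r"
  where "A ** L = mat 1" "L ** A = mat 1" "\<And>i j. A $ i $ j \<in> \<int>" "\<And>i j. L $ i $ j \<in> \<int>"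
    "\<And>i j. (L ** M) $ i $ j \<in> {0, 1, -1}" "\<And>i. column (c i) (L ** M) = axis i 1"
proof -
  define A :: "real^'r^'r" where "A = (\<chi> i j. M $ i $ c j)"
  have colA: "column i A = column (c i) M" for i by (simp add: A_def column_def)
  have "card (columns A) = CARD('r)"
  proof -
    have "columns A = (\<lambda>j. column j M) ` range c" by (auto simp: columns_def colA)
    then show ?thesis using c by (simp add: column_indep_def card_image)
  qed
  moreover have "independent (columns A)"
  proof -
    have "columns A = (\<lambda>j. column j M) ` range c" by (auto simp: columns_def colA)
    then show ?thesis using c by (simp add: column_indep_def)
  qed
  ultimately have "rank A = CARD('r)"
    by (simp add: column_rank_def dim_eq_card_independent)
  then have "det A \<noteq> 0"
    by (metis full_rank_injective det_nz_iff_inj matrix_of_matrix_vector_mul matrix_vector_mul_linear)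
  then have detA: "det A \<in> {1, -1}" using minors[OF c(1)] by (auto simp: A_def)
  obtain L where L: "A ** L = mat 1" "L ** A = mat 1"
    using \<open>det A \<noteq> 0\<close> unfolding invertible_det_nz[symmetric] invertible_def by blast
  have solve: "(L *v b) $ k = det (\<chi> i j. if j = k then b $ i else A $ i $ j) / det A" for b k
  proof -
    have "A *v (L *v b) = b" by (simp add: matrix_vector_mul_assoc L)
    then show ?thesis by (simp add: cramer[OF \<open>det A \<noteq> 0\<close>])
  qed
  have Aint: "A $ i $ j \<in> \<int>" for i j using int by (simp add: A_def)
  have "L $ i $ j \<in> \<int>" for i j
  proof -
    have "L $ i $ j = (L *v axis j 1) $ i"
      by (simp add: matrix_vector_mult_basis column_def)
    moreover have "det (\<chi> i' j'. if j' = i then axis j 1 $ i' else A $ i' $ j') \<in> (\<int> :: real set)"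
      by (rule det_in_Ints) (use Aint in \<open>auto simp: axis_def\<close>)
    ultimately show ?thesis using solve[of "axis j 1" i] detA by auto
  qed
  moreover have "(L ** M) $ k $ j \<in> {0, 1, -1}" for k j
  proof -
    \<comment> \<open>Cramer's rule replaces basis column \<open>k\<close> by column
      \<open>j\<close> of \<open>M\<close>. If \<open>j\<close> is already another basis column, two
      columns coincide and the determinant is \<open>0\<close>.\<close>
    let ?c = "c(k := j)"
    have "(\<chi> i j'. if j' = k then column j M $ i else A $ i $ j') = (\<chi> i j. M $ i $ ?c j)"
      by (auto simp: vec_eq_iff A_def column_def)
    moreover have "(L ** M) $ k $ j = (L *v column j M) $ k"
      by (metis column_matrix_mult column_def vec_lambda_beta)
    moreover have "det (\<chi> i j. M $ i $ ?c j) \<in> {0, 1, -1}"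
    proof (cases "inj ?c")
      case True
      then show ?thesis using minors by blast
    next
      case False
      then obtain a b where "a \<noteq> b" "?c a = ?c b" by (auto simp: inj_on_def)
      then have "det (\<chi> i j. M $ i $ ?c j) = 0"
        by (intro det_identical_columns[of a b]) (auto simp: column_def)
      then show ?thesis by simp
    qed
    ultimately show ?thesis using solve[of "column j M" k] detA by auto
  qed
  moreover have "column (c i) (L ** M) = axis i 1" for i
  proof -
    have "column (c i) (L ** M) = column i (L ** A)" by (simp add: column_matrix_mult colA)
    then show ?thesis by (simp add: L mat_def column_def axis_def vec_eq_iff)
  qed
  ultimately show thesis using that[OF L Aint] by blast
qed

text \<open>Enumerating a basis by the row type makes the basis block a square matrix.\<close>

lemma full_rank_basis_enumeration:
  fixes M :: "real^'n^'r"
  assumes "rank M = CARD('r)"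
  obtains c :: "'r \<Rightarrow> 'n" where "inj c" "column_indep M (range c)"
proof -
  let ?c = "\<lambda>j. column j M"
  obtain B where B: "B \<subseteq> columns M" "independent B" "card B = dim (columns M)"
    by (rule basis_exists)
  have cols: "columns M = range ?c" by (auto simp: columns_def)
  obtain J where J: "inj_on ?c J" "B = ?c ` J"
    using B(1) unfolding cols subset_image_inj by blast
  have "card J = CARD('r)" using J B assms by (simp add: card_image column_rank_def)
  then obtain f where "bij_betw f (UNIV :: 'r set) J"
    using finite_same_card_bij[of "UNIV :: 'r set" J] by auto
  then show thesis using that[of f] J B by (auto simp: bij_betw_def column_indep_def)
qed

text \<open>\<open>F\<close> reduces \<open>M\<close> to standard form, corrects the row signs, and
  undoes the reduction of \<open>N\<close>. All three factors are integral with integral inverses;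
  the column signs remain as \<open>t\<close>.\<close>

lemma same_matroid_unimodular_equivalent:
  fixes M N :: "real^'n^'r"
  assumes rank: "rank M = CARD('r)"
    and int: "\<And>i j. M $ i $ j \<in> \<int>" "\<And>i j. N $ i $ j \<in> \<int>"
    and minors: "\<And>c :: 'r \<Rightarrow> 'n. inj c \<Longrightarrow> det (\<chi> i j. M $ i $ c j) \<in> {0, 1, -1}"
      "\<And>c :: 'r \<Rightarrow> 'n. inj c \<Longrightarrow> det (\<chi> i j. N $ i $ c j) \<in> {0, 1, -1}"
    and eq: "\<And>X. column_indep M X \<longleftrightarrow> column_indep N X"
  obtains F G :: "real^'r^'r" and t :: "'n \<Rightarrow> real"
  where "F ** G = mat 1" "G ** F = mat 1" "\<And>i j. F $ i $ j \<in> \<int>" "\<And>i j. G $ i $ j \<in> \<int>"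
    "\<And>j. t j \<in> {1, -1}" "\<And>j. F *v column j M = t j *\<^sub>R column j N"
proof -
  obtain c :: "'r \<Rightarrow> 'n" where c: "inj c" "column_indep M (range c)"
    using full_rank_basis_enumeration[OF rank] by blast
  obtain A L where A: "A ** L = mat 1" "L ** A = mat 1" "\<And>i j. A $ i $ j \<in> \<int>" "\<And>i j. L $ i $ j \<in> \<int>"
    "\<And>i j. (L ** M) $ i $ j \<in> {0, 1, -1}" "\<And>i. column (c i) (L ** M) = axis i 1"
    using weakly_unimodular_standard_form[OF int(1) minors(1) c] by blast
  \<comment> \<open>By \<open>eq\<close> the same \<open>c\<close> enumerates a basis for
    \<open>N\<close>, so both standard forms have their unit columns at the same places.\<close>
  obtain B K where B: "B ** K = mat 1" "K ** B = mat 1" "\<And>i j. B $ i $ j \<in> \<int>" "\<And>i j. K $ i $ j \<in> \<int>"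
    "\<And>i j. (K ** N) $ i $ j \<in> {0, 1, -1}" "\<And>i. column (c i) (K ** N) = axis i 1"
    using weakly_unimodular_standard_form[OF int(2) minors(2) c(1)] c(2) eq by metis
  have "invertible L" "invertible K" using A(1,2) B(1,2) by (auto simp: invertible_def)
  then have eq': "column_indep (L ** M) X \<longleftrightarrow> column_indep (K ** N) X" for X
    by (simp add: column_indep_invertible_mult eq)
  obtain s t where s: "\<And>i. s i \<in> {1, -1::real}" and t: "\<And>j. t j \<in> {1, -1::real}"
    and st: "\<And>i j. (K ** N) $ i $ j = s i * (L ** M) $ i $ j * t j"
    using same_matroid_standard_form_signs[OF A(5) B(5) A(6) B(6) eq'] by metis
  define S :: "real^'r^'r" where "S = (\<chi> i j. if i = j then s i else 0)"
  have Sv: "(S *v x) $ i = s i * x $ i" for x i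
    by (simp add: S_def matrix_vector_mult_def if_distrib[of "\<lambda>z. z * _"] cong: if_cong)
  have ss: "s i * s i = 1" for i using s[of i] by auto
  have tt: "t i * t i = 1" for i using t[of i] by auto
  have "S *v (S *v x) = mat 1 *v x" for x by (simp add: vec_eq_iff Sv ss flip: mult.assoc)
  then have SS: "S ** S = mat 1"
    by (simp add: matrix_eq flip: matrix_vector_mul_assoc)
  have Sint: "S $ i $ j \<in> \<int>" for i j using s[of i] by (auto simp: S_def)
  have mint: "(X ** Y) $ i $ j \<in> \<int>" if "\<And>i j. X $ i $ j \<in> \<int>" "\<And>i j. Y $ i $ j \<in> \<int>"
    for X Y :: "real^'r^'r" and i j
    by (simp add: matrix_matrix_mult_def) (intro Ints_sum Ints_mult that)
  \<comment> \<open>The sign matrix \<open>S\<close> is its own inverse, so products of the two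
    candidate inverses collapse from the inside.\<close>
  have cancel: "X ** S ** Z ** (Y ** S ** W) = X ** W" if "Z ** Y = mat 1" for X Y Z W :: "real^'r^'r"
    using that SS by (metis matrix_mul_assoc matrix_mul_rid)
  show thesis
  proof
    show "(B ** S ** L) ** (A ** S ** K) = mat 1" using cancel A B by simp
    show "(A ** S ** K) ** (B ** S ** L) = mat 1" using cancel A B by simp
    show "(B ** S ** L) $ i $ j \<in> \<int>" "(A ** S ** K) $ i $ j \<in> \<int>" for i j
      using A B Sint mint by auto
    show "t j \<in> {1, -1}" for j by (rule t)
    fix j
    have "S *v column j (L ** M) = t j *\<^sub>R column j (K ** N)"
      using tt[of j] by (simp add: vec_eq_iff Sv column_def st)
    then have "(B ** S ** L) *v column j M = B *v (t j *\<^sub>R column j (K ** N))"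
      by (simp add: column_matrix_mult flip: matrix_vector_mul_assoc)
    also have "\<dots> = t j *\<^sub>R ((B ** K) *v column j N)"
      by (simp add: matrix_vector_mult_scaleR column_matrix_mult matrix_vector_mul_assoc)
    finally show "(B ** S ** L) *v column j M = t j *\<^sub>R column j N" using B by simp
  qed
qed

section \<open>The polytopes and their polars\<close>

lemma columns_sym_block: "columns (sym_block M) = range (\<lambda>j. column j M) \<union> range (\<lambda>j. - column j M)"
proof -
  have "column (Inl j) (sym_block M) = column j M" "column (Inr j) (sym_block M) = - column j M" for j
    by (simp_all add: vec_eq_iff column_def sym_block_def)
  moreover have "columns (sym_block M) = (\<lambda>k. column k (sym_block M)) ` (range Inl \<union> range Inr)"
    by (auto simp: columns_def simp flip: UNIV_sum)
  ultimately show ?thesis by (simp add: image_Un image_image)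
qed

text \<open>The generators come in pairs of opposite points, so the polytope forgets both the signs
  and the order of the columns.\<close>

lemma sym_polytope_image:
  fixes M N :: "real^'n^'r" and \<sigma> :: "'n \<Rightarrow> 'n"
  assumes "bij \<sigma>" and t: "\<And>j. t j \<in> {1, -1}"
    and F: "\<And>j. F *v column j M = t j *\<^sub>R column (\<sigma> j) N"
  shows "sym_polytope N = (*v) F ` sym_polytope M"
proof -
  have 1: "{F *v column j M, F *v (- column j M)} = {column (\<sigma> j) N, - column (\<sigma> j) N}" for j
    using t[of j] F[of j] linear_neg[OF matrix_vector_mul_linear, of F "column j M"] by auto
  have "(*v) F ` columns (sym_block M) = (\<Union>j. {F *v column j M, F *v (- column j M)})"
    unfolding columns_sym_block by auto
  also have "\<dots> = (\<Union>k\<in>range \<sigma>. {column k N, - column k N})"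
    unfolding 1 by auto
  also have "\<dots> = columns (sym_block N)"
    unfolding columns_sym_block using \<open>bij \<sigma>\<close> by (auto simp: bij_def)
  finally show ?thesis
    unfolding sym_polytope_def by (simp add: convex_hull_linear_image)
qed

lemma map_matrix_of_int_mult:
  "map_matrix real_of_int (A ** B) = map_matrix real_of_int A ** map_matrix real_of_int B"
  by (simp add: vec_eq_iff matrix_matrix_mult_def)

lemma map_matrix_of_int_mat: "map_matrix real_of_int (mat 1) = mat 1"
  by (simp add: vec_eq_iff mat_def)

lemma psi_psi: "psi A (psi B x) = psi (A ** B) x"
  by (simp add: psi_def map_matrix_of_int_mult matrix_vector_mul_assoc)

lemma psi_mat_1: "psi (mat 1) x = x"
  by (simp add: psi_def map_matrix_of_int_mat)

lemma inner_psi_transpose: "psi (transpose F) u \<bullet> x = u \<bullet> psi F x"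
proof -
  have "map_matrix real_of_int (transpose F) = transpose (map_matrix real_of_int F)"
    by (simp add: vec_eq_iff transpose_def)
  then show ?thesis by (simp add: psi_def dot_lmul_matrix)
qed

text \<open>Moving \<open>F\<close> across the inner product shows that the polar of the image is
  the preimage of the polar under the transpose, hence its image under the inverse.\<close>

lemma polar_psi_image:
  fixes F :: "int^'r^'r"
  assumes "invertible F"
  shows "polar (psi F ` P) = psi (matrix_inv (transpose F)) ` polar P"
proof -
  let ?H = "matrix_inv (transpose F)"
  obtain G where "F ** G = mat 1" "G ** F = mat 1" using assms by (auto simp: invertible_def)
  then have "transpose F ** transpose G = mat 1 \<and> transpose G ** transpose F = mat 1"
    by (metis matrix_transpose_mul transpose_mat)
  \<comment> \<open>\<open>matrix_inv\<close> chooses some two-sided inverse, so it suffices that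
    one exists over the integers: the transpose of \<open>G\<close>.\<close>
  then have H: "transpose F ** ?H = mat 1 \<and> ?H ** transpose F = mat 1"
    unfolding matrix_inv_def by (rule someI)
  have iff: "u \<in> polar (psi F ` P) \<longleftrightarrow> psi (transpose F) u \<in> polar P" for u
    by (simp add: polar_def inner_psi_transpose)
  have inv: "psi (transpose F) (psi ?H x) = x" "psi ?H (psi (transpose F) x) = x" for x
    using H by (simp_all add: psi_psi psi_mat_1)
  show ?thesis
  proof (intro set_eqI iffI)
    fix u assume "u \<in> polar (psi F ` P)"
    then show "u \<in> psi ?H ` polar P" using iff inv(2) by (metis imageI)
  next
    fix u assume "u \<in> psi ?H ` polar P"
    then show "u \<in> polar (psi F ` P)" using iff inv(1) by auto
  qed
qed

lemma integral_matrix_of_int: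
  fixes F :: "real^'m^'k"
  assumes "\<And>i j. F $ i $ j \<in> \<int>"
  obtains F' :: "int^'m^'k" where "map_matrix real_of_int F' = F"
proof
  show "map_matrix real_of_int (\<chi> i j. \<lfloor>F $ i $ j\<rfloor>) = F"
    using assms by (simp add: vec_eq_iff)
qed

theorem theorem3p2:
  fixes E :: "'a set" and indep :: "'a set \<Rightarrow> bool"
    and M\<^sub>1 M\<^sub>2 :: "real^'n^'r"
  assumes "regular_matroid TYPE('r) TYPE('n) E indep"
    and "matroid_rank indep = CARD('r)"
    and "card E = CARD('n)"
    and "full_rank_weakly_unimodular M\<^sub>1" and "represents M\<^sub>1 E indep"
    and "full_rank_weakly_unimodular M\<^sub>2" and "represents M\<^sub>2 E indep"
  shows "\<exists>F :: int^'r^'r. invertible F \<and>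
    sym_polytope M\<^sub>2 = psi F ` sym_polytope M\<^sub>1 \<and>
    polar (sym_polytope M\<^sub>2) = psi (matrix_inv (transpose F)) ` polar (sym_polytope M\<^sub>1)"
proof -
  obtain \<phi>\<^sub>1 \<phi>\<^sub>2 where bij: "bij_betw \<phi>\<^sub>1 UNIV E" "bij_betw \<phi>\<^sub>2 UNIV E"
    and iso: "\<And>X. column_indep M\<^sub>1 X \<longleftrightarrow> indep (\<phi>\<^sub>1 ` X)" "\<And>X. column_indep M\<^sub>2 X \<longleftrightarrow> indep (\<phi>\<^sub>2 ` X)"
    using assms(5,7) unfolding represents_def matroid_isomorphic_def by auto
  \<comment> \<open>\<open>\<sigma>\<close> sends a column of \<open>M\<^sub>1\<close> to the column
    of \<open>M\<^sub>2\<close> that stands for the same matroid element.\<close>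
  define \<sigma> where "\<sigma> = inv_into UNIV \<phi>\<^sub>2 \<circ> \<phi>\<^sub>1"
  have \<sigma>: "bij \<sigma>" unfolding \<sigma>_def
    using bij bij_betw_inv_into bij_betw_trans by metis
  have "\<phi>\<^sub>2 (\<sigma> j) = \<phi>\<^sub>1 j" for j
    using bij by (auto simp: \<sigma>_def bij_betw_def intro!: f_inv_into_f)
  then have "\<phi>\<^sub>2 ` \<sigma> ` X = \<phi>\<^sub>1 ` X" for X by (simp add: image_image)
  then have \<sigma>_iso: "column_indep M\<^sub>1 X \<longleftrightarrow> column_indep M\<^sub>2 (\<sigma> ` X)" for X by (simp add: iso)
  \<comment> \<open>Permuting the columns of \<open>M\<^sub>2\<close> turns the isomorphism of
    matroids into equality of the independent index sets.\<close>
  define N :: "real^'n^'r" where "N = (\<chi> i j. M\<^sub>2 $ i $ \<sigma> j)"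
  have colN: "column j N = column (\<sigma> j) M\<^sub>2" for j by (simp add: N_def column_def)
  have inj: "inj_on \<sigma> X" for X using \<sigma> by (auto simp: bij_def inj_on_def)
  have "column_indep N X \<longleftrightarrow> column_indep M\<^sub>2 (\<sigma> ` X)" for X
    using comp_inj_on_iff[OF inj[of X], of "\<lambda>j. column j M\<^sub>2"]
    by (simp add: column_indep_def colN image_image o_def)
  then have eq: "column_indep M\<^sub>1 X \<longleftrightarrow> column_indep N X" for X by (simp add: \<sigma>_iso)
  have minors: "det (\<chi> i j. N $ i $ c j) \<in> {0, 1, -1}" if "inj c" for c :: "'r \<Rightarrow> 'n"
  proof -
    have "inj (\<sigma> \<circ> c)" using that inj by (intro comp_inj_on)
    then have "det (\<chi> i j. M\<^sub>2 $ i $ (\<sigma> \<circ> c) j) \<in> {0, 1, -1}"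
      using assms(6) unfolding full_rank_weakly_unimodular_def by blast
    then show ?thesis by (simp add: N_def)
  qed
  obtain F G :: "real^'r^'r" and t
    where FG: "F ** G = mat 1" "G ** F = mat 1" "\<And>i j. F $ i $ j \<in> \<int>" "\<And>i j. G $ i $ j \<in> \<int>"
      and t: "\<And>j. t j \<in> {1, -1}" "\<And>j. F *v column j M\<^sub>1 = t j *\<^sub>R column j N"
    by (rule same_matroid_unimodular_equivalent[of M\<^sub>1 N])
      (use assms(4,6) minors eq in \<open>auto simp: full_rank_weakly_unimodular_def N_def\<close>)
  obtain F' G' where F': "map_matrix real_of_int F' = F" and G': "map_matrix real_of_int G' = G"
    using integral_matrix_of_int[OF FG(3)] integral_matrix_of_int[OF FG(4)] by metis
  have of_int_inj: "A = B" if "map_matrix real_of_int A = map_matrix real_of_int B"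
    for A B :: "int^'r^'r"
    using that by (simp add: vec_eq_iff)
  \<comment> \<open>Both \<open>F\<close> and its inverse are lifted to integer matrices, which
    gives invertibility over the integers and not merely over the reals.\<close>
  have "F' ** G' = mat 1" "G' ** F' = mat 1"
    by (rule of_int_inj; simp add: map_matrix_of_int_mult map_matrix_of_int_mat F' G' FG)+
  then have "invertible F'" by (auto simp: invertible_def)
  moreover have P: "sym_polytope M\<^sub>2 = psi F' ` sym_polytope M\<^sub>1"
  proof -
    have "sym_polytope M\<^sub>2 = (*v) F ` sym_polytope M\<^sub>1"
      using \<sigma> t(1) by (rule sym_polytope_image[where t = t]) (simp add: t(2) colN)
    then show ?thesis by (simp add: psi_def[abs_def] F')
  qed
  ultimately show ?thesis using polar_psi_image by metis
qed

end
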